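(* Let $N\ge 2$ and let $u\in\mathrm{LSC}(\mathbb{R}^N)$ be a viscosity supersolution of $\lambda_{N-1}(D^2u)=0$ in $\mathbb{R}^N$ satisfying $\min_{\mathbb{R}^N}u=0$. Then every connected component of the positivity set $\{x\in\mathbb{R}^N : u(x)>0\}$ is convex.
   Context: For a real symmetric $N\times N$ matrix $X$, $\lambda_1(X)\le\dots\le\lambda_N(X)$ denote its eigenvalues in nondecreasing order. $\mathrm{LSC}(\mathbb{R}^N)$ is the set of lower semicontinuous functions $\mathbb{R}^N\to\mathbb{R}$. A function $u\in\mathrm{LSC}(\mathbb{R}^N)$ is a (viscosity) supersolution of $\lambda_{N-1}(D^2u)=0$ in $\mathbb{R}^N$ if, whenever $\phi\in C^2(\mathbb{R}^N)$ and $u-\phi$ has a local minimum at $\hat x$, one has $\lambda_{N-1}(D^2\phi(\hat x))\le 0$. *)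

theory Defs
  imports "HOL-Analysis.Analysis"
begin

definition eigenspace :: "real^'n^'n \<Rightarrow> real \<Rightarrow> (real^'n) set" where
  "eigenspace A c = {v. A *v v = c *\<^sub>R v}"

definition spectrum :: "real^'n^'n \<Rightarrow> real set" where
  "spectrum A = {c. \<exists>v. v \<noteq> 0 \<and> A *v v = c *\<^sub>R v}"

text \<open>
  The real eigenvalues in nondecreasing order, each repeated according to the dimension of
  its eigenspace. For a symmetric matrix geometric and algebraic multiplicities agree, so
  the list then has length \<open>CARD('n)\<close>. (The spectrum of a matrix is always finite.)
\<close>

definition eigenvalue_list :: "real^'n^'n \<Rightarrow> real list" where
  "eigenvalue_list A =
     concat (map (\<lambda>c. replicate (dim (eigenspace A c)) c) (sorted_list_of_set (spectrum A)))"

text \<open>\<open>nth_eigenvalue k\<close> is \<open>\<lambda>\<^sub>k\<close> for \<open>1 \<le> k \<le> CARD('n)\<close>; lists are indexed from 0.\<close>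

definition nth_eigenvalue :: "nat \<Rightarrow> real^'n^'n \<Rightarrow> real" where
  "nth_eigenvalue k A = eigenvalue_list A ! (k - 1)"

definition gradient :: "(real^'n \<Rightarrow> real) \<Rightarrow> real^'n \<Rightarrow> real^'n" where
  "gradient \<phi> x = (\<chi> i. frechet_derivative \<phi> (at x) (axis i 1))"

definition hessian :: "(real^'n \<Rightarrow> real) \<Rightarrow> real^'n \<Rightarrow> real^'n^'n" where
  "hessian \<phi> x = matrix (frechet_derivative (gradient \<phi>) (at x))"

definition C2 :: "(real^'n \<Rightarrow> real) \<Rightarrow> bool" where
  "C2 \<phi> \<longleftrightarrow> (\<forall>x. \<phi> differentiable (at x)) \<and> (\<forall>x. gradient \<phi> differentiable (at x)) \<and>
     continuous_on UNIV (hessian \<phi>)"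

definition lsc :: "('a::topological_space \<Rightarrow> real) \<Rightarrow> bool" where
  "lsc u \<longleftrightarrow> (\<forall>x. \<forall>c < u x. \<forall>\<^sub>F y in nhds x. c < u y)"

definition has_local_min :: "('a::topological_space \<Rightarrow> real) \<Rightarrow> 'a \<Rightarrow> bool" where
  "has_local_min f x \<longleftrightarrow> (\<forall>\<^sub>F y in nhds x. f x \<le> f y)"

text \<open>Viscosity supersolutions of \<open>\<lambda>\<^sub>k(D\<^sup>2u) = 0\<close> on the whole space.\<close>

definition viscosity_supersolution :: "nat \<Rightarrow> (real^'n \<Rightarrow> real) \<Rightarrow> bool" where
  "viscosity_supersolution k u \<longleftrightarrow> lsc u \<and>
     (\<forall>\<phi> x. C2 \<phi> \<and> has_local_min (\<lambda>y. u y - \<phi> y) x \<longrightarrow> nth_eigenvalue k (hessian \<phi> x) \<le> 0)"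

end

theory Submission
  imports Defs
begin

text \<open>
  The key step is a triangle lemma: if \<open>u > 0\<close> on two sides of a triangle, then \<open>u > 0\<close> on the
  third. Otherwise \<open>u\<close> vanishes at a point \<open>p\<close> of the third side. Let \<open>w\<close> be a small multiple of
  a strictly convex quadratic in the plane of the triangle, minus a large multiple of the squared
  distance to that plane, such that \<open>w(p) > 0\<close> but \<open>w \<le> 0\<close> slightly beyond the third side. On a
  thickened, slightly enlarged triangle \<open>u - w\<close> then has a negative minimum, which cannot lie on
  the boundary, so \<open>w\<close> touches \<open>u\<close> from below (up to a constant) although \<open>D\<^sup>2w\<close> has two positive
  eigenvalues. Given the triangle lemma, the set of points of a component \<open>C\<close> visible from a fixed
  \<open>x \<in> C\<close> within \<open>C\<close> is open and closed in \<open>C\<close>, hence equal to \<open>C\<close>.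
\<close>

section \<open>Lower semicontinuous functions\<close>

text \<open>Without a minimum every \<open>x\<close> in \<open>S\<close> has some \<open>g x\<close>
  in \<open>S\<close> of smaller value, and neighbourhoods \<open>U x\<close> on which
  \<open>f\<close> exceeds \<open>f (g x)\<close> cover \<open>S\<close>. In a finite subcover the
  smallest value \<open>f (g d)\<close> is undercut again, because \<open>g d\<close> itself lies in
  some \<open>U x\<close>.\<close>

lemma lsc_attains_min:
  fixes f :: "'a::topological_space \<Rightarrow> real"
  assumes "lsc f" "compact S" "S \<noteq> {}"
  obtains x where "x \<in> S" "\<And>y. y \<in> S \<Longrightarrow> f x \<le> f y"
proof (rule ccontr)
  assume "\<not> thesis"
  then have "\<forall>x\<in>S. \<exists>y\<in>S. f y < f x"
    using that by (meson not_le)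
  then obtain g where g: "\<And>x. x \<in> S \<Longrightarrow> g x \<in> S \<and> f (g x) < f x"
    by metis
  have "\<exists>U. open U \<and> x \<in> U \<and> (\<forall>y\<in>U. f (g x) < f y)" if "x \<in> S" for x
    using assms(1) g[OF that] unfolding lsc_def eventually_nhds by blast
  then obtain U where U: "\<And>x. x \<in> S \<Longrightarrow> open (U x) \<and> x \<in> U x \<and> (\<forall>y\<in>U x. f (g x) < f y)"
    by metis
  obtain D where D: "D \<subseteq> S" "finite D" "S \<subseteq> (\<Union>x\<in>D. U x)"
    using compactE_image[OF assms(2), of S U] U by blast
  then have "D \<noteq> {}" using assms(3) by auto
  then obtain d where d: "d \<in> D" "\<And>x. x \<in> D \<Longrightarrow> f (g d) \<le> f (g x)"
    using D(2) arg_min_if_finite[of D "f \<circ> g"] by (metis comp_apply not_le)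
  then obtain x where "x \<in> D" "g d \<in> U x" using D g by blast
  then have "f (g x) < f (g d)" using U D by blast
  then show False using d(2) \<open>x \<in> D\<close> by force
qed

lemma lsc_diff_continuous:
  fixes u :: "'a::t2_space \<Rightarrow> real"
  assumes "lsc u" "continuous_on UNIV w"
  shows "lsc (\<lambda>x. u x - w x)"
  unfolding lsc_def
proof (intro allI impI)
  fix x c assume c: "c < u x - w x"
  define e where "e = (u x - w x - c) / 2"
  have "e > 0" using c by (simp add: e_def)
  have 1: "\<forall>\<^sub>F y in nhds x. u x - e < u y"
    using assms(1) \<open>e > 0\<close> by (simp add: lsc_def)
  have "isCont w x" using assms(2) by (simp add: continuous_on_eq_continuous_at)
  then have "(w \<longlongrightarrow> w x) (nhds x)"
    using continuous_at tendsto_nhds_iff by blast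
  then have 2: "\<forall>\<^sub>F y in nhds x. w y < w x + e"
    using \<open>e > 0\<close> by (simp add: order_tendstoD(2))
  show "\<forall>\<^sub>F y in nhds x. c < u y - w y"
    using 1 2 by eventually_elim (simp add: e_def field_simps)
qed

lemma open_superlevel_lsc:
  assumes "lsc u"
  shows "open {x. c < u x}"
proof (subst open_subopen, intro ballI)
  fix x assume "x \<in> {x. c < u x}"
  then have "\<forall>\<^sub>F y in nhds x. c < u y" using assms by (simp add: lsc_def)
  then show "\<exists>T. open T \<and> x \<in> T \<and> T \<subseteq> {x. c < u x}"
    unfolding eventually_nhds by (metis Collect_mem_eq mem_Collect_eq subsetI)
qed

section \<open>Spectrum of a scaled plane projection shifted by a scalar\<close>

text \<open>\<open>M\<close> is \<alpha> times the orthogonal projection onto the plane of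
  \<open>f1\<close>, \<open>f2\<close>, minus \<beta> times the identity. The plane is the
  eigenspace of \<alpha> - \<beta>, its orthogonal complement that of -\<beta>; since \<alpha> > 0,
  the double eigenvalue \<alpha> - \<beta> occupies the top two places.\<close>

lemma nth_eigenvalue_plane:
  fixes M :: "real^'n^'n" and f1 f2 :: "real^'n"
  assumes f: "norm f1 = 1" "norm f2 = 1" "f1 \<bullet> f2 = 0"
    and M: "\<And>v. M *v v = \<alpha> *\<^sub>R ((f1 \<bullet> v) *\<^sub>R f1 + (f2 \<bullet> v) *\<^sub>R f2) - \<beta> *\<^sub>R v"
    and \<alpha>: "0 < \<alpha>"
  shows "nth_eigenvalue (CARD('n) - 1) M = \<alpha> - \<beta>"
proof -
  have f': "f1 \<bullet> f1 = 1" "f2 \<bullet> f2 = 1" "f2 \<bullet> f1 = 0" "f1 \<noteq> 0" "f2 \<noteq> 0" "f1 \<noteq> f2"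
    using f by (auto simp: norm_eq_1 inner_commute)
  have eq: "M *v v = (\<alpha> - \<beta>) *\<^sub>R v \<longleftrightarrow> (f1 \<bullet> v) *\<^sub>R f1 + (f2 \<bullet> v) *\<^sub>R f2 = v" for v
    using \<alpha> by (simp add: M algebra_simps flip: scaleR_add_right)
  have "eigenspace M (\<alpha> - \<beta>) = span {f1, f2}"
  proof
    show "eigenspace M (\<alpha> - \<beta>) \<subseteq> span {f1, f2}"
      unfolding eigenspace_def eq
      by clarsimp (metis insertI1 insert_commute span_add span_base span_scale)
    show "span {f1, f2} \<subseteq> eigenspace M (\<alpha> - \<beta>)"
      unfolding eigenspace_def eq span_insert
      by (auto simp: inner_add_right inner_diff_right f f' algebra_simps)
  qed
  moreover have "independent {f1, f2}"
    using f' f by (intro pairwise_orthogonal_independent)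
      (auto simp: pairwise_def orthogonal_def)
  ultimately have d1: "dim (eigenspace M (\<alpha> - \<beta>)) = 2"
    using f' by (simp add: dim_eq_card_independent)
  have neg: "M *v v = (- \<beta>) *\<^sub>R v \<longleftrightarrow> f1 \<bullet> v = 0 \<and> f2 \<bullet> v = 0" for v
  proof -
    have "M *v v = (- \<beta>) *\<^sub>R v \<longleftrightarrow> (f1 \<bullet> v) *\<^sub>R f1 + (f2 \<bullet> v) *\<^sub>R f2 = 0"
      using \<alpha> by (simp add: M)
    also have "\<dots> \<longleftrightarrow> f1 \<bullet> v = 0 \<and> f2 \<bullet> v = 0"
    proof
      assume *: "(f1 \<bullet> v) *\<^sub>R f1 + (f2 \<bullet> v) *\<^sub>R f2 = 0"
      have "f1 \<bullet> ((f1 \<bullet> v) *\<^sub>R f1 + (f2 \<bullet> v) *\<^sub>R f2) = f1 \<bullet> v"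
        "f2 \<bullet> ((f1 \<bullet> v) *\<^sub>R f1 + (f2 \<bullet> v) *\<^sub>R f2) = f2 \<bullet> v"
        by (simp_all add: inner_add_right f f')
      then show "f1 \<bullet> v = 0 \<and> f2 \<bullet> v = 0" unfolding * by simp
    qed auto
    finally show ?thesis .
  qed
  have "eigenspace M (- \<beta>) = {y \<in> UNIV. \<forall>x\<in>span {f1, f2}. orthogonal x y}"
    unfolding eigenspace_def neg
    by (auto simp: orthogonal_def span_base inner_commute
        intro: orthogonal_to_span[unfolded orthogonal_def, of _ "{f1, f2}"])
  moreover have "dim {y \<in> UNIV. \<forall>x\<in>span {f1, f2}. orthogonal x y} + dim (span {f1, f2})
      = dim (UNIV :: (real^'n) set)"
    by (intro dim_subspace_orthogonal_to_vectors) auto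
  ultimately have d2: "dim (eigenspace M (- \<beta>)) + 2 = CARD('n)"
    using \<open>independent {f1, f2}\<close> f' by (simp add: dim_eq_card_independent)
  have spec: "c = \<alpha> - \<beta> \<or> c = - \<beta>" if v: "v \<noteq> 0" "M *v v = c *\<^sub>R v" for c v
  proof (rule ccontr)
    assume c: "\<not> (c = \<alpha> - \<beta> \<or> c = - \<beta>)"
    have "f \<bullet> v = 0" if "f = f1 \<or> f = f2" for f
    proof -
      have "c * (f \<bullet> v) = f \<bullet> (M *v v)" using v by simp
      also have "\<dots> = \<alpha> * (f \<bullet> v) - \<beta> * (f \<bullet> v)"
        unfolding M using that by (auto simp: inner_diff_right inner_add_right f f')
      finally have "(c - (\<alpha> - \<beta>)) * (f \<bullet> v) = 0" by (simp add: algebra_simps)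
      then show ?thesis using c by simp
    qed
    then have "M *v v = (- \<beta>) *\<^sub>R v" using neg by blast
    then show False using v c by (metis scaleR_right_imp_eq)
  qed
  have mem: "c \<in> spectrum M \<longleftrightarrow> dim (eigenspace M c) \<noteq> 0" for c
    unfolding spectrum_def eigenspace_def by (auto simp: dim_eq_0)
  have sub: "spectrum M \<subseteq> {- \<beta>, \<alpha> - \<beta>}"
    using spec unfolding spectrum_def by blast
  have "eigenvalue_list M = replicate (CARD('n) - 2) (- \<beta>) @ replicate 2 (\<alpha> - \<beta>)"
  \<comment> \<open>In dimension 2 the complement of the plane is trivial, so -\<beta> is not an
    eigenvalue and the sorted spectrum has only one entry.\<close>
  proof (cases "CARD('n) = 2")
    case True
    then have "- \<beta> \<notin> spectrum M" "\<alpha> - \<beta> \<in> spectrum M"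
      unfolding mem using d1 d2 True by linarith+
    then have "spectrum M = {\<alpha> - \<beta>}" using sub by blast
    then show ?thesis unfolding eigenvalue_list_def by (simp add: d1 True)
  next
    case False
    then have "- \<beta> \<in> spectrum M" "\<alpha> - \<beta> \<in> spectrum M"
      unfolding mem using d1 d2 False by linarith+
    then have "spectrum M = {- \<beta>, \<alpha> - \<beta>}" using sub by blast
    then have "sorted_list_of_set (spectrum M) = [- \<beta>, \<alpha> - \<beta>]"
      using \<alpha> by (simp add: sorted_list_of_set.sorted_key_list_of_set_insert_remove)
    moreover have "dim (eigenspace M (- \<beta>)) = CARD('n) - 2" using d2 by simp
    ultimately show ?thesis unfolding eigenvalue_list_def by (simp add: d1)
  qed
  \<comment> \<open>With lists indexed from 0 the entry sought has index
    \<open>CARD('n) - 2\<close>, the first one of the second block.\<close>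
  then show ?thesis by (simp add: nth_eigenvalue_def nth_append numeral_2_eq_2)
qed

section \<open>Quadratic test functions\<close>

text \<open>The quadratic polynomial with value \<open>k\<close> and gradient \<open>g\<close> at
  \<open>b\<close>. Subtracting \<open>K\<close> times the full squared norm, not only its part
  normal to the plane, gives the Hessian the form treated in \<open>nth_eigenvalue_plane\<close>;
  for orthonormal \<open>f1\<close>, \<open>f2\<close> the net quadratic coefficient in the plane is
  \<open>B - K\<close>.\<close>

definition saddle :: "real^'n \<Rightarrow> real^'n \<Rightarrow> real \<Rightarrow> real \<Rightarrow> real \<Rightarrow> real^'n \<Rightarrow> real^'n \<Rightarrow> real^'n \<Rightarrow> real" where
  "saddle f1 f2 B K k g b x = k + g \<bullet> (x - b)
     + B * ((f1 \<bullet> (x - b))\<^sup>2 + (f2 \<bullet> (x - b))\<^sup>2) - K * (norm (x - b))\<^sup>2"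

lemma gradient_saddle:
  "saddle f1 f2 B K k g b differentiable (at x)"
  "gradient (saddle f1 f2 B K k g b) x =
     g + (2 * B) *\<^sub>R ((f1 \<bullet> (x - b)) *\<^sub>R f1 + (f2 \<bullet> (x - b)) *\<^sub>R f2) - (2 * K) *\<^sub>R (x - b)"
proof -
  let ?G = "g + (2 * B) *\<^sub>R ((f1 \<bullet> (x - b)) *\<^sub>R f1 + (f2 \<bullet> (x - b)) *\<^sub>R f2) - (2 * K) *\<^sub>R (x - b)"
  have d: "(saddle f1 f2 B K k g b has_derivative (\<lambda>h. ?G \<bullet> h)) (at x)"
    unfolding saddle_def [abs_def] power2_norm_eq_inner
    by (auto intro!: derivative_eq_intros simp: fun_eq_iff inner_add_left inner_diff_left
        inner_commute algebra_simps)
  then show "saddle f1 f2 B K k g b differentiable (at x)"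
    by (auto simp: differentiable_def)
  show "gradient (saddle f1 f2 B K k g b) x = ?G"
    unfolding gradient_def frechet_derivative_at[OF d, symmetric]
    by (simp add: vec_eq_iff inner_axis)
qed

lemma hessian_saddle:
  "gradient (saddle f1 f2 B K k g b) differentiable (at x)"
  "hessian (saddle f1 f2 B K k g b) x *v v =
     (2 * B) *\<^sub>R ((f1 \<bullet> v) *\<^sub>R f1 + (f2 \<bullet> v) *\<^sub>R f2) - (2 * K) *\<^sub>R v"
  "hessian (saddle f1 f2 B K k g b) x = hessian (saddle f1 f2 B K k g b) b"
proof -
  let ?H = "\<lambda>v. (2 * B) *\<^sub>R ((f1 \<bullet> v) *\<^sub>R f1 + (f2 \<bullet> v) *\<^sub>R f2) - (2 * K) *\<^sub>R v"
  have eq: "gradient (saddle f1 f2 B K k g b) = (\<lambda>x. g + ?H (x - b))"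
    by (simp add: fun_eq_iff gradient_saddle algebra_simps)
  have d: "(gradient (saddle f1 f2 B K k g b) has_derivative ?H) (at x)" for x
    unfolding eq by (auto intro!: derivative_eq_intros simp: algebra_simps)
  then show "gradient (saddle f1 f2 B K k g b) differentiable (at x)"
    by (auto simp: differentiable_def)
  have h: "hessian (saddle f1 f2 B K k g b) x = matrix ?H" for x
    unfolding hessian_def frechet_derivative_at[OF d, symmetric] ..
  then show "hessian (saddle f1 f2 B K k g b) x = hessian (saddle f1 f2 B K k g b) b"
    by simp
  have "linear ?H" using d by (rule has_derivative_linear)
  then show "hessian (saddle f1 f2 B K k g b) x *v v = ?H v"
    unfolding h using matrix_works[of ?H v] by (simp add: linear_matrix_vector_mul_eq)
qed

text \<open>The only use of the viscosity inequality: the relevant eigenvalue of the test function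
  is \<open>2 * B - 2 * K > 0\<close>.\<close>

lemma supersolution_no_saddle_below:
  fixes u :: "real^'n \<Rightarrow> real"
  assumes u: "viscosity_supersolution (CARD('n) - 1) u"
    and f: "norm f1 = 1" "norm f2 = 1" "f1 \<bullet> f2 = 0" and "0 < B" "K < B"
  shows "\<not> has_local_min (\<lambda>y. u y - saddle f1 f2 B K k g b y) x"
proof
  let ?w = "saddle f1 f2 B K k g b"
  assume "has_local_min (\<lambda>y. u y - ?w y) x"
  moreover have "hessian ?w = (\<lambda>x. hessian ?w b)"
    using hessian_saddle(3) by blast
  then have "continuous_on UNIV (hessian ?w)"
    by (metis continuous_on_const)
  then have "C2 ?w"
    unfolding C2_def using gradient_saddle(1) hessian_saddle(1) by blast
  ultimately have "nth_eigenvalue (CARD('n) - 1) (hessian ?w x) \<le> 0"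
    using u unfolding viscosity_supersolution_def by blast
  moreover have "nth_eigenvalue (CARD('n) - 1) (hessian ?w x) = 2 * B - 2 * K"
    using nth_eigenvalue_plane[OF f hessian_saddle(2)] \<open>0 < B\<close> by auto
  ultimately show False using \<open>K < B\<close> by simp
qed

section \<open>Coordinates in the plane of a triangle\<close>

text \<open>The orthonormal basis serves the Hessian, the oblique one the triangle; the last
  identity writes the orthogonal projection onto the plane in both. Gram-Schmidt gives
  \<open>f1\<close>, \<open>f2\<close>.\<close>

lemma plane_coordinates:
  fixes e1 e2 :: "'a::euclidean_space"
  assumes "\<not> collinear {0, e1, e2}"
  obtains f1 f2 \<alpha> \<beta> where "norm f1 = 1" "norm f2 = 1" "f1 \<bullet> f2 = 0"
    "\<alpha> \<bullet> e1 = 1" "\<alpha> \<bullet> e2 = 0" "\<beta> \<bullet> e1 = 0" "\<beta> \<bullet> e2 = 1"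
    "\<And>y. (f1 \<bullet> y) *\<^sub>R f1 + (f2 \<bullet> y) *\<^sub>R f2 = (\<alpha> \<bullet> y) *\<^sub>R e1 + (\<beta> \<bullet> y) *\<^sub>R e2"
proof -
  have ne: "e1 \<noteq> 0" "e2 \<noteq> c *\<^sub>R e1" for c
    using assms by (auto simp: collinear_lemma)
  define p where "p = norm e1"
  define f1 where "f1 = e1 /\<^sub>R p"
  define q where "q = f1 \<bullet> e2"
  define d where "d = e2 - q *\<^sub>R f1"
  define r where "r = norm d"
  define f2 where "f2 = d /\<^sub>R r"
  have "p > 0" using ne by (simp add: p_def)
  have "d \<noteq> 0" using ne(2)[of "q / p"] by (simp add: d_def f1_def divide_inverse)
  then have "r > 0" by (simp add: r_def)
  have n1: "norm f1 = 1" using \<open>p > 0\<close> by (simp add: f1_def p_def)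
  have n2: "norm f2 = 1" using \<open>r > 0\<close> by (simp add: f2_def r_def)
  have "f1 \<bullet> d = 0" using n1 by (simp add: d_def q_def inner_diff_right norm_eq_1)
  then have orth: "f1 \<bullet> f2 = 0" by (simp add: f2_def)
  have e1: "e1 = p *\<^sub>R f1" using \<open>p > 0\<close> by (simp add: f1_def)
  have e2: "e2 = q *\<^sub>R f1 + r *\<^sub>R f2" using \<open>r > 0\<close> by (simp add: f2_def d_def)
  \<comment> \<open>The triangular system \<open>e1 = p f1\<close>, \<open>e2 = q f1 + r f2\<close>
    solved for the coordinates of a projected vector: first the coefficient of \<open>e2\<close>,
    then that of \<open>e1\<close>.\<close>
  define \<beta> where "\<beta> = f2 /\<^sub>R r"
  define \<alpha> where "\<alpha> = (f1 - q *\<^sub>R \<beta>) /\<^sub>R p"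
  have i: "f1 \<bullet> f1 = 1" "f2 \<bullet> f2 = 1" "f2 \<bullet> f1 = 0"
    using n1 n2 orth by (auto simp: norm_eq_1 inner_commute)
  show thesis
  proof
    show "norm f1 = 1" "norm f2 = 1" "f1 \<bullet> f2 = 0" by fact+
    show "\<alpha> \<bullet> e1 = 1" "\<alpha> \<bullet> e2 = 0" "\<beta> \<bullet> e1 = 0" "\<beta> \<bullet> e2 = 1"
      unfolding e1 e2 \<alpha>_def \<beta>_def using \<open>p > 0\<close> \<open>r > 0\<close> orth
      by (simp_all add: inner_add_right inner_diff_left i)
    show "(f1 \<bullet> y) *\<^sub>R f1 + (f2 \<bullet> y) *\<^sub>R f2 = (\<alpha> \<bullet> y) *\<^sub>R e1 + (\<beta> \<bullet> y) *\<^sub>R e2" for y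
    proof -
      have "(\<alpha> \<bullet> y) *\<^sub>R e1 = (f1 \<bullet> y - q * (\<beta> \<bullet> y)) *\<^sub>R f1"
        unfolding e1 \<alpha>_def using \<open>p > 0\<close> by (simp add: inner_diff_left)
      moreover have "(\<beta> \<bullet> y) *\<^sub>R e2 = (q * (\<beta> \<bullet> y)) *\<^sub>R f1 + (f2 \<bullet> y) *\<^sub>R f2"
        unfolding e2 \<beta>_def using \<open>r > 0\<close> by (simp add: scaleR_add_right field_simps)
      ultimately show ?thesis by (simp add: algebra_simps)
    qed
  qed
qed

text \<open>Truncating the parameter at 1 moves the point by at most \<open>r / 2\<close>, and
  dropping \<open>n\<close> by at most another \<open>r / 2\<close>. This places two faces of the
  enlarged, thickened triangle near the sides on which \<open>u\<close> is positive.\<close>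

lemma near_closed_segment:
  fixes b e n :: "'a::real_normed_vector"
  assumes "0 \<le> t" "t \<le> 1 + \<delta>" "\<delta> * norm e \<le> r / 2" "norm n \<le> r / 2" "0 \<le> \<delta>"
  shows "\<exists>z\<in>closed_segment b (b + e). b + t *\<^sub>R e + n \<in> cball z r"
proof
  define s where "s = min t 1"
  show "b + s *\<^sub>R e \<in> closed_segment b (b + e)"
    unfolding closed_segment_def using assms by (auto simp: s_def algebra_simps intro!: exI[of _ s])
  have "dist (b + s *\<^sub>R e) (b + t *\<^sub>R e + n) = norm ((t - s) *\<^sub>R e + n)"
    by (simp add: dist_norm norm_minus_commute algebra_simps)
  also have "\<dots> \<le> (t - s) * norm e + norm n"
    using norm_triangle_ineq[of "(t - s) *\<^sub>R e" n] by (simp add: s_def)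
  also have "\<dots> \<le> \<delta> * norm e + norm n"
    using assms by (intro add_right_mono mult_right_mono) (auto simp: s_def)
  finally show "b + t *\<^sub>R e + n \<in> cball (b + s *\<^sub>R e) r" using assms by simp
qed

section \<open>Positivity on the third side of a triangle\<close>

lemma supersolution_positive_on_noncollinear_segment:
  fixes u :: "real^'n \<Rightarrow> real"
  assumes u: "viscosity_supersolution (CARD('n) - 1) u" and nonneg: "\<forall>x. 0 \<le> u x"
    and seg: "closed_segment b a \<union> closed_segment b c \<subseteq> {x. 0 < u x}"
    and nc: "\<not> collinear {a, b, c}"
    and p: "p \<in> closed_segment a c"
  shows "0 < u p"
proof (rule ccontr)
  assume "\<not> 0 < u p"
  then have up: "u p = 0" using nonneg by (metis le_less)
  have lsc: "lsc u" using u by (simp add: viscosity_supersolution_def)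
  define e1 where "e1 = a - b"
  define e2 where "e2 = c - b"
  have "\<not> collinear {0, e1, e2}"
    using nc collinear_3[of a b c] by (simp add: e1_def e2_def NO_MATCH_def)
  then obtain f1 f2 \<alpha> \<beta> where f: "norm f1 = 1" "norm f2 = 1" "f1 \<bullet> f2 = 0"
    and dual: "\<alpha> \<bullet> e1 = 1" "\<alpha> \<bullet> e2 = 0" "\<beta> \<bullet> e1 = 0" "\<beta> \<bullet> e2 = 1"
    and P: "\<And>y. (f1 \<bullet> y) *\<^sub>R f1 + (f2 \<bullet> y) *\<^sub>R f2 = (\<alpha> \<bullet> y) *\<^sub>R e1 + (\<beta> \<bullet> y) *\<^sub>R e2"
    by (rule plane_coordinates) blast
  define L where "L = closed_segment b a \<union> closed_segment b c"
  have L: "compact L" "L \<noteq> {}" by (auto simp: L_def)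
  obtain z0 where z0: "z0 \<in> L" "\<And>y. y \<in> L \<Longrightarrow> u z0 \<le> u y"
    using lsc_attains_min[OF lsc L] by blast
  \<comment> \<open>Half the minimum, so that \<open>u > m\<close> holds strictly on
    \<open>L\<close> and hence on a closed tube of some radius \<open>r\<close> around it.\<close>
  define m where "m = u z0 / 2"
  have "m > 0" using z0 seg by (auto simp: m_def L_def)
  have "L \<subseteq> {x. m < u x}" using z0 \<open>m > 0\<close> by (force simp: m_def)
  then obtain r where r: "r > 0" "(\<Union>x\<in>L. cball x r) \<subseteq> {x. m < u x}"
    using compact_subset_open_imp_cball_epsilon_subset[OF L(1) open_superlevel_lsc[OF lsc]] by metis
  define E where "E = norm e1 + norm e2"
  have "e1 \<noteq> 0" using dual by auto
  then have "E > 0" by (simp add: E_def add_pos_nonneg)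
  \<comment> \<open>The enlargement beyond the third side, small enough that extending either side
    by the factor 1 + \<delta> stays within \<open>r / 2\<close> of it.\<close>
  define \<delta> where "\<delta> = r / (2 * E)"
  have "\<delta> > 0" using r \<open>E > 0\<close> by (simp add: \<delta>_def)
  have "\<delta> * E = r / 2" using \<open>E > 0\<close> by (simp add: \<delta>_def)
  then have \<delta>: "\<delta> * norm e1 \<le> r / 2" "\<delta> * norm e2 \<le> r / 2"
    using \<open>\<delta> > 0\<close> by (auto simp: E_def distrib_left intro: order_trans[rotated])
  define M where "M = (1 + \<delta>) * E"
  have "M > 0" using \<open>\<delta> > 0\<close> \<open>E > 0\<close> by (simp add: M_def)
  \<comment> \<open>\<open>M\<close> will bound \<open>norm (h x)\<close> on the region
    \<open>S\<close>, so the convex term adds at most \<delta> / 2 to the bracket in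
    \<open>w\<close>. Together with the constant 1 + \<delta> / 2 this keeps the bracket nonpositive
    at \<open>s x + t x = 1 + \<delta>\<close>, yet positive on the third side, where the sum is
    1.\<close>
  define \<eta> where "\<eta> = \<delta> / (2 * M\<^sup>2)"
  have "\<eta> > 0" "\<eta> * M\<^sup>2 = \<delta> / 2" using \<open>M > 0\<close> \<open>\<delta> > 0\<close> by (auto simp: \<eta>_def)
  \<comment> \<open>Scales \<open>w\<close> so that \<open>w \<le> m\<close> on
    \<open>S\<close>.\<close>
  define \<epsilon> where "\<epsilon> = m / (1 + \<delta>)"
  have "\<epsilon> > 0" "\<epsilon> * (1 + \<delta>) = m" using \<open>m > 0\<close> \<open>\<delta> > 0\<close> by (auto simp: \<epsilon>_def)
  \<comment> \<open>Makes the normal penalty equal to \<open>m\<close> at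
    \<open>norm (n x) = r / 2\<close>, which forces \<open>w \<le> 0\<close> there.\<close>
  define K where "K = 4 * m / r\<^sup>2"
  have "K > 0" "K * (r / 2)\<^sup>2 = m" using \<open>m > 0\<close> \<open>r > 0\<close> by (auto simp: K_def power_divide)
  \<comment> \<open>Oblique coordinates with origin \<open>b\<close>: the third side is
    \<open>s x + t x = 1\<close> with both nonnegative and \<open>n x = 0\<close>. Here
    \<open>h x\<close> is the in-plane part of \<open>x - b\<close> and \<open>n x\<close> the
    normal part.\<close>
  define s where "s x = \<alpha> \<bullet> (x - b)" for x
  define t where "t x = \<beta> \<bullet> (x - b)" for x
  define h where "h x = s x *\<^sub>R e1 + t x *\<^sub>R e2" for x
  define n where "n x = x - b - h x" for x
  have x: "x = b + h x + n x" for x by (simp add: n_def)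
  \<comment> \<open>By Pythagoras the summand \<open>K\<close> in the first coefficient cancels the
    in-plane part of the subtracted squared norm, leaving \<epsilon> * \<eta> > 0 in the plane and
    \<open>- K\<close> across it.\<close>
  define w where "w = saddle f1 f2 (\<epsilon> * \<eta> + K) K (\<epsilon> * (1 + \<delta> / 2)) (- \<epsilon> *\<^sub>R (\<alpha> + \<beta>)) b"
  have ff: "f1 \<bullet> f1 = 1" "f2 \<bullet> f2 = 1" "f2 \<bullet> f1 = 0"
    using f by (auto simp: norm_eq_1 inner_commute)
  have hP: "h x = (f1 \<bullet> (x - b)) *\<^sub>R f1 + (f2 \<bullet> (x - b)) *\<^sub>R f2" for x
    unfolding h_def s_def t_def P ..
  have nh: "(norm (h x))\<^sup>2 = (f1 \<bullet> (x - b))\<^sup>2 + (f2 \<bullet> (x - b))\<^sup>2" for x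
    unfolding hP power2_norm_eq_inner
    by (simp add: inner_add_left inner_add_right ff f power2_eq_square)
  have "f1 \<bullet> n x = 0" "f2 \<bullet> n x = 0" for x
    unfolding n_def hP by (simp_all add: inner_diff_right inner_add_right ff f)
  then have "h x \<bullet> n x = 0" for x
    unfolding hP by (simp add: inner_add_left)
  then have "(norm (h x + n x))\<^sup>2 = (norm (h x))\<^sup>2 + (norm (n x))\<^sup>2" for x
    by (simp add: norm_add_Pythagorean orthogonal_def)
  then have pyth: "(norm (x - b))\<^sup>2 = (norm (h x))\<^sup>2 + (norm (n x))\<^sup>2" for x
    by (simp add: n_def)
  have w: "w x = \<epsilon> * (1 + \<delta> / 2 - (s x + t x) + \<eta> * (norm (h x))\<^sup>2) - K * (norm (n x))\<^sup>2" for x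
    unfolding w_def saddle_def pyth nh[symmetric]
    by (simp add: s_def t_def inner_add_left algebra_simps)
  have contw: "continuous_on UNIV w"
    unfolding w [abs_def] s_def t_def h_def n_def by (intro continuous_intros)

  \<comment> \<open>The triangle thickened in the normal directions and enlarged only past the side
    containing \<open>p\<close>.\<close>
  define S where "S = {x. 0 \<le> s x \<and> 0 \<le> t x \<and> s x + t x \<le> 1 + \<delta> \<and> norm (n x) \<le> r / 2}"
  have hM: "norm (h x) \<le> M" if "x \<in> S" for x
  proof -
    have "norm (h x) \<le> s x * norm e1 + t x * norm e2"
      using that norm_triangle_ineq[of "s x *\<^sub>R e1" "t x *\<^sub>R e2"] by (simp add: h_def S_def)
    also have "\<dots> \<le> (1 + \<delta>) * norm e1 + (1 + \<delta>) * norm e2"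
      using that by (intro add_mono mult_right_mono) (auto simp: S_def)
    finally show ?thesis by (simp add: M_def E_def distrib_left)
  qed
  have "dist b x \<le> M + r / 2" if "x \<in> S" for x
  proof -
    have "dist b x = norm (h x + n x)" by (simp add: dist_norm norm_minus_commute n_def)
    also have "\<dots> \<le> norm (h x) + norm (n x)" by (rule norm_triangle_ineq)
    finally show ?thesis using hM[OF that] that by (simp add: S_def)
  qed
  then have "bounded S" by (auto simp: bounded_def)
  moreover have "closed S"
    unfolding S_def s_def t_def h_def n_def
    by (intro closed_Collect_conj closed_Collect_le continuous_intros)
  ultimately have "compact S" by (simp add: compact_eq_bounded_closed)

  obtain \<tau> where \<tau>: "0 \<le> \<tau>" "\<tau> \<le> 1" "p = (1 - \<tau>) *\<^sub>R a + \<tau> *\<^sub>R c"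
    using p by (auto simp: closed_segment_def)
  then have pb: "p - b = (1 - \<tau>) *\<^sub>R e1 + \<tau> *\<^sub>R e2"
    by (simp add: e1_def e2_def algebra_simps)
  have stp: "s p = 1 - \<tau>" "t p = \<tau>" unfolding s_def t_def pb by (simp_all add: inner_add_right dual)
  then have np: "n p = 0" by (simp add: n_def h_def pb)
  then have "p \<in> S" using stp \<tau> \<open>\<delta> > 0\<close> \<open>r > 0\<close> by (simp add: S_def)
  have "w p = \<epsilon> * (\<delta> / 2 + \<eta> * (norm (h p))\<^sup>2)" by (simp add: w np stp)
  then have "w p > 0" using \<open>\<epsilon> > 0\<close> \<open>\<delta> > 0\<close> \<open>\<eta> > 0\<close> by (simp add: add_pos_nonneg)

  obtain z where z: "z \<in> S" "\<And>y. y \<in> S \<Longrightarrow> u z - w z \<le> u y - w y"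
    using lsc_attains_min[OF lsc_diff_continuous[OF lsc contw] \<open>compact S\<close>] \<open>p \<in> S\<close> by blast
  \<comment> \<open>At \<open>p\<close> the difference \<open>u - w\<close> equals
    \<open>- w p < 0\<close>, so its minimum over \<open>S\<close> is negative.\<close>
  have uw: "u z < w z" using z(2)[OF \<open>p \<in> S\<close>] up \<open>w p > 0\<close> by simp
  have zS: "0 \<le> s z" "0 \<le> t z" "s z + t z \<le> 1 + \<delta>" "norm (n z) \<le> r / 2"
    using z by (auto simp: S_def)
  have "\<eta> * (norm (h z))\<^sup>2 \<le> \<eta> * M\<^sup>2"
    using hM[OF z(1)] \<open>\<eta> > 0\<close> by (intro mult_left_mono power_mono) auto
  then have "\<eta> * (norm (h z))\<^sup>2 \<le> \<delta> / 2" using \<open>\<eta> * M\<^sup>2 = \<delta> / 2\<close> by simp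
  then have "\<epsilon> * (1 + \<delta> / 2 - (s z + t z) + \<eta> * (norm (h z))\<^sup>2) \<le> \<epsilon> * (1 + \<delta> - (s z + t z))"
    using \<open>\<epsilon> > 0\<close> by (intro mult_left_mono) auto
  then have wle: "w z \<le> \<epsilon> * (1 + \<delta> - (s z + t z)) - K * (norm (n z))\<^sup>2"
    by (simp add: w)
  have "\<epsilon> * (1 + \<delta> - (s z + t z)) \<le> \<epsilon> * (1 + \<delta>)"
    using zS \<open>\<epsilon> > 0\<close> by (intro mult_left_mono) auto
  then have wm: "w z \<le> m - K * (norm (n z))\<^sup>2"
    using wle \<open>\<epsilon> * (1 + \<delta>) = m\<close> by simp
  have Kn: "0 \<le> K * (norm (n z))\<^sup>2" using \<open>K > 0\<close> by simp
  then have wm': "w z \<le> m" using wm by linarith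
  have wpos: "0 < w z" using uw nonneg[rule_format, of z] by linarith
  have tube: "m < u z" if "y \<in> L" "z \<in> cball y r" for y
    using r that by blast
  \<comment> \<open>The minimum point \<open>z\<close> avoids every face of \<open>S\<close>: the
    faces \<open>s = 0\<close> and \<open>t = 0\<close> lie in the tube where
    \<open>u > m \<ge> w\<close>, and on the other two \<open>w \<le> 0\<close>, against
    \<open>0 \<le> u z < w z\<close>.\<close>
  have "s z \<noteq> 0"
  proof
    assume "s z = 0"
    then have "z = b + t z *\<^sub>R e2 + n z" using x[of z] by (simp add: h_def)
    then have "\<exists>y\<in>closed_segment b c. z \<in> cball y r"
      using near_closed_segment[of "t z" \<delta> e2 r "n z" b] zS \<delta> \<open>\<delta> > 0\<close> \<open>s z = 0\<close> by (simp add: e2_def)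
    then show False using tube wm' uw by (auto simp: L_def)
  qed
  moreover have "t z \<noteq> 0"
  proof
    assume "t z = 0"
    then have "z = b + s z *\<^sub>R e1 + n z" using x[of z] by (simp add: h_def)
    then have "\<exists>y\<in>closed_segment b a. z \<in> cball y r"
      using near_closed_segment[of "s z" \<delta> e1 r "n z" b] zS \<delta> \<open>\<delta> > 0\<close> \<open>t z = 0\<close> by (simp add: e1_def)
    then show False using tube wm' uw by (auto simp: L_def)
  qed
  moreover have "s z + t z \<noteq> 1 + \<delta>"
  proof
    assume "s z + t z = 1 + \<delta>"
    then show False using wle Kn wpos by simp
  qed
  moreover have "norm (n z) \<noteq> r / 2"
  proof
    assume "norm (n z) = r / 2"
    then show False using wm[unfolded \<open>norm (n z) = r / 2\<close>] \<open>K * (r / 2)\<^sup>2 = m\<close> wpos by linarith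
  qed
  moreover define U where "U = {x. 0 < s x \<and> 0 < t x \<and> s x + t x < 1 + \<delta> \<and> norm (n x) < r / 2}"
  ultimately have "z \<in> U" using zS by simp
  moreover have "open U"
    unfolding U_def s_def t_def h_def n_def by (intro open_Collect_conj open_Collect_less continuous_intros)
  moreover have "U \<subseteq> S" by (auto simp: U_def S_def)
  ultimately have "has_local_min (\<lambda>y. u y - w y) z"
    unfolding has_local_min_def eventually_nhds using z(2) by blast
  then show False
    using supersolution_no_saddle_below[OF u f] \<open>\<epsilon> > 0\<close> \<open>\<eta> > 0\<close> \<open>K > 0\<close>
    unfolding w_def by (metis add_pos_pos less_add_same_cancel2 mult_pos_pos)
qed

text \<open>In the degenerate case one of the three points lies between the other two, and in each
  arrangement the two given segments already cover the third.\<close>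

lemma supersolution_positive_on_segment:
  fixes u :: "real^'n \<Rightarrow> real"
  assumes "viscosity_supersolution (CARD('n) - 1) u" "\<forall>x. 0 \<le> u x"
    and seg: "closed_segment b a \<subseteq> {x. 0 < u x}" "closed_segment b c \<subseteq> {x. 0 < u x}"
  shows "closed_segment a c \<subseteq> {x. 0 < u x}"
proof (cases "collinear {a, b, c}")
  case True
  then consider "a \<in> closed_segment b c" | "b \<in> closed_segment a c" | "c \<in> closed_segment b a"
    by (auto simp: collinear_between_cases between_mem_segment closed_segment_commute)
  then have "closed_segment a c \<subseteq> closed_segment b a \<union> closed_segment b c"
  proof cases
    case 1
    then show ?thesis using Un_closed_segment[of a b c] by blast
  next
    case 2
    then show ?thesis using Un_closed_segment[of b a c] by (simp add: closed_segment_commute)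
  next
    case 3
    then show ?thesis using Un_closed_segment[of c b a] by (auto simp: closed_segment_commute)
  qed
  then show ?thesis using seg by blast
next
  case False
  then show ?thesis
    using supersolution_positive_on_noncollinear_segment[OF assms(1,2)] seg by blast
qed

section \<open>Convexity of the components\<close>

theorem theorem12:
  fixes u :: "real^'n \<Rightarrow> real"
  assumes "CARD('n) \<ge> 2"
    and "lsc u"
    and "viscosity_supersolution (CARD('n) - 1) u"
    and "\<forall>x. u x \<ge> 0" and "\<exists>x. u x = 0"
  shows "\<forall>C \<in> components {x. u x > 0}. convex C"
proof
  let ?\<Omega> = "{x. 0 < u x}"
  fix C assume C: "C \<in> components ?\<Omega>"
  have "open C" using C open_superlevel_lsc[OF assms(2)] open_components by blast
  have "connected C" and sub: "C \<subseteq> ?\<Omega>" using C in_components_connected in_components_subset by blast+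
  \<comment> \<open>A segment is connected, so by maximality the component absorbs it once it meets
    \<open>C\<close> and lies in the positivity set.\<close>
  have stay: "closed_segment x y \<subseteq> C" if "closed_segment x y \<subseteq> ?\<Omega>" "x \<in> C" for x y
    using components_maximal[OF C, of "closed_segment x y"] that by auto
  have triangle: "closed_segment x z \<subseteq> C"
    if "closed_segment x y \<subseteq> C" "closed_segment y z \<subseteq> C" for x y z
  proof (rule stay)
    have "closed_segment y x \<subseteq> ?\<Omega>" "closed_segment y z \<subseteq> ?\<Omega>"
      using that sub closed_segment_commute[of x y] by blast+
    then show "closed_segment x z \<subseteq> ?\<Omega>"
      by (rule supersolution_positive_on_segment[OF assms(3,4)])
    show "x \<in> C" using that(1) by (rule subsetD) simp
  qed
  show "convex C"
    unfolding convex_contains_segment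
  proof (intro ballI)
    fix x y assume xy: "x \<in> C" "y \<in> C"
    define V where "V = {y \<in> C. closed_segment x y \<subseteq> C}"
    \<comment> \<open>Visibility from \<open>x\<close> is locally constant on \<open>C\<close>: for
      \<open>z\<close> in a small ball around \<open>y\<close> the segment from \<open>y\<close> to
      \<open>z\<close> lies in \<open>C\<close>, and \<open>triangle\<close> transfers visibility
      both ways. This makes both \<open>V\<close> and \<open>C - V\<close> open.\<close>
    have near: "\<exists>e>0. ball y e \<subseteq> C \<and> (\<forall>z\<in>ball y e. z \<in> V \<longleftrightarrow> y \<in> V)" if "y \<in> C" for y
    proof -
      obtain e where e: "e > 0" "ball y e \<subseteq> C"
        using \<open>open C\<close> \<open>y \<in> C\<close> openE by blast
      have "z \<in> V \<longleftrightarrow> y \<in> V" if "z \<in> ball y e" for z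
      proof -
        have "closed_segment y z \<subseteq> C" "z \<in> C"
          using closed_segment_subset[of y "ball y e" z] that e by auto
        then show ?thesis
          using triangle[of x y z] triangle[of x z y] \<open>y \<in> C\<close> closed_segment_commute[of y z]
          unfolding V_def by blast
      qed
      then show ?thesis using e by blast
    qed
    have "open V"
      unfolding open_contains_ball
    proof
      fix y assume "y \<in> V"
      then have "y \<in> C" by (simp add: V_def)
      then obtain e where "e > 0" "\<forall>z\<in>ball y e. z \<in> V \<longleftrightarrow> y \<in> V" using near by blast
      then show "\<exists>e>0. ball y e \<subseteq> V" using \<open>y \<in> V\<close> by (intro exI[of _ e]) (simp add: subset_iff)
    qed
    moreover have "open (C - V)"
      unfolding open_contains_ball
    proof
      fix y assume "y \<in> C - V"
      then have "y \<in> C" "y \<notin> V" by auto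
      then obtain e where e: "e > 0" "ball y e \<subseteq> C" "\<forall>z\<in>ball y e. z \<in> V \<longleftrightarrow> y \<in> V"
        using near by blast
      then have "\<forall>z\<in>ball y e. z \<notin> V" using \<open>y \<notin> V\<close> by metis
      then have "ball y e \<subseteq> C - V" using e(2) by blast
      then show "\<exists>e>0. ball y e \<subseteq> C - V" using e(1) by metis
    qed
    moreover have "x \<in> V" using xy by (simp add: V_def)
    ultimately have "V \<inter> C = {} \<or> (C - V) \<inter> C = {}"
      by (intro connectedD[OF \<open>connected C\<close>]) blast+
    then have "y \<in> V" using \<open>x \<in> V\<close> xy by blast
    then show "closed_segment x y \<subseteq> C" by (simp add: V_def)
  qed
qed

end
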